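(* Let $A$ be a real division algebra with a left-unit $e$ (that is, $ex=x$ for all $x\in A$) such that $(x,x,x^2)=0$ for all $x\in A$. Then $e$ is a two-sided unit element of $A$ and $A$ is a quadratic algebra.
   Context: An algebra over a field is a vector space with a bilinear product, not assumed associative, commutative or unital. The associator is $(x,y,z)=(xy)z-x(yz)$, and $x^2=xx$. A real division algebra is a (nonzero) finite-dimensional algebra $A$ over $\mathbb{R}$ such that for every $x\in A\setminus\{0\}$ the left and right multiplication operators $L_x:y\mapsto xy$ and $R_x:y\mapsto yx$ are bijective. An algebra $A$ is quadratic if it contains a two-sided unit element $e$ and for every $x\in A$ the elements $e,x,x^2$ are linearly dependent. *)

theory Defs
  imports "HOL-Analysis.Analysis"
begin

text \<open>
  A real algebra is a type of class \<open>real_vector\<close> together with a bilinear product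
  \<open>m\<close>, passed as an explicit argument: none of the multiplicative type classes fits,
  since the product need not be associative, commutative or unital.
\<close>

definition associator :: "('a::real_vector \<Rightarrow> 'a \<Rightarrow> 'a) \<Rightarrow> 'a \<Rightarrow> 'a \<Rightarrow> 'a \<Rightarrow> 'a" where
  "associator m x y z = m (m x y) z - m x (m y z)"

definition left_unit :: "('a \<Rightarrow> 'a \<Rightarrow> 'a) \<Rightarrow> 'a \<Rightarrow> bool" where
  "left_unit m e \<longleftrightarrow> (\<forall>x. m e x = x)"

definition two_sided_unit :: "('a \<Rightarrow> 'a \<Rightarrow> 'a) \<Rightarrow> 'a \<Rightarrow> bool" where
  "two_sided_unit m e \<longleftrightarrow> (\<forall>x. m e x = x \<and> m x e = x)"

definition real_division_algebra :: "('a::real_vector \<Rightarrow> 'a \<Rightarrow> 'a) \<Rightarrow> bool" where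
  "real_division_algebra m \<longleftrightarrow>
     bilinear m \<and>
     (\<exists>B :: 'a set. finite B \<and> span B = UNIV) \<and>
     (\<exists>x :: 'a. x \<noteq> 0) \<and>
     (\<forall>x. x \<noteq> 0 \<longrightarrow> bij (\<lambda>y. m x y) \<and> bij (\<lambda>y. m y x))"

text \<open>
  Linear dependence is meant for the family \<open>(u, v, w)\<close>, so repetitions count:
  \<open>dependent {u, v, w}\<close> would be wrong, because the set collapses when two of the
  vectors coincide (for instance \<open>x = e\<close> in the definition of a quadratic algebra).
\<close>

definition linearly_dependent3 :: "'a::real_vector \<Rightarrow> 'a \<Rightarrow> 'a \<Rightarrow> bool" where
  "linearly_dependent3 u v w \<longleftrightarrow>
     (\<exists>a b c :: real. (a, b, c) \<noteq> (0, 0, 0) \<and> a *\<^sub>R u + b *\<^sub>R v + c *\<^sub>R w = 0)"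

definition quadratic_algebra :: "('a::real_vector \<Rightarrow> 'a \<Rightarrow> 'a) \<Rightarrow> bool" where
  "quadratic_algebra m \<longleftrightarrow>
     bilinear m \<and>
     (\<exists>e. two_sided_unit m e \<and> (\<forall>x. linearly_dependent3 e x (m x x)))"

end

theory Submission
  imports Defs "HOL-Computational_Algebra.Fundamental_Theorem_Algebra"
begin

text \<open>
  Linearizing \<open>x\<^sup>2 x\<^sup>2 = x (x x\<^sup>2)\<close> at \<open>x = e\<close> shows that right multiplication by \<open>e\<close> is
  idempotent, hence the identity since it is bijective. Linearizing in the direction \<open>e\<close> then
  gives \<open>x\<^sup>2 x = x x\<^sup>2\<close>, and these two identities make the algebra power-associative (Albert).
  So evaluation of real polynomials at \<open>x\<close> is multiplicative; some nonzero polynomial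
  annihilates \<open>x\<close> by finite dimension, and as there are no zero divisors so does one of its real
  factors of degree at most 2.
\<close>

section \<open>Linearization of identities\<close>

text \<open>The differences \<open>f 1 - f (-1)\<close> and \<open>f 2 - f (-2)\<close> involve only
  \<open>v1\<close> and \<open>v3\<close>, and the factor 8 makes \<open>v3\<close> cancel.
  Extracting a linear coefficient in this way is the tool for linearizing identities over the
  reals.\<close>

lemma quartic_linear_coeff_zero:
  fixes v0 v1 v2 v3 v4 :: "'a::real_vector"
  assumes "\<And>t::real. v0 + t *\<^sub>R v1 + t^2 *\<^sub>R v2 + t^3 *\<^sub>R v3 + t^4 *\<^sub>R v4 = 0"
  shows "v1 = 0"
proof -
  define f where "f t = v0 + t *\<^sub>R v1 + t^2 *\<^sub>R v2 + t^3 *\<^sub>R v3 + t^4 *\<^sub>R v4" for t :: real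
  have "f 1 - f (-1) = 2 *\<^sub>R v1 + 2 *\<^sub>R v3"
    by (simp add: f_def scaleR_2)
  moreover have "f 2 - f (-2) = 4 *\<^sub>R v1 + 16 *\<^sub>R v3"
    using scaleR_left_distrib[of 2 2 v1] scaleR_left_distrib[of 8 8 v3] by (simp add: f_def)
  moreover have "8 *\<^sub>R (2 *\<^sub>R v1 + 2 *\<^sub>R v3) - (4 *\<^sub>R v1 + 16 *\<^sub>R v3) = 12 *\<^sub>R v1"
    using scaleR_left_diff_distrib[of 16 4 v1] by (simp add: scaleR_right_distrib)
  moreover have "f t = 0" for t
    using assms by (simp add: f_def)
  ultimately have "12 *\<^sub>R v1 = 0"
    by (metis diff_zero scaleR_zero_right)
  then show ?thesis by simp
qed

locale real_algebra_product =
  fixes m :: "'a::real_vector \<Rightarrow> 'a \<Rightarrow> 'a" (infixl "\<cdot>" 70)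
  assumes bilin: "bilinear m"
begin

lemmas ladd = bilinear_ladd[OF bilin] and radd = bilinear_radd[OF bilin]
  and lmul = bilinear_lmul[OF bilin] and rmul = bilinear_rmul[OF bilin]
  and lzero [simp] = bilinear_lzero[OF bilin] and rzero [simp] = bilinear_rzero[OF bilin]
  and lsub = bilinear_lsub[OF bilin] and rsub = bilinear_rsub[OF bilin]

lemmas bilin_simps = ladd radd lmul rmul lsub rsub

text \<open>Substituting \<open>x + t *\<^sub>R y\<close> makes the identity a quartic in
  \<open>t\<close>, whose linear coefficient is taken. The instances \<open>x = e\<close> and
  \<open>y = e\<close> later give the right unit and the cube identity.\<close>

lemma square_square_linearized:
  assumes "\<And>x. (x \<cdot> x) \<cdot> (x \<cdot> x) = x \<cdot> (x \<cdot> (x \<cdot> x))"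
  shows "(x \<cdot> y + y \<cdot> x) \<cdot> (x \<cdot> x) + (x \<cdot> x) \<cdot> (x \<cdot> y + y \<cdot> x)
    = y \<cdot> (x \<cdot> (x \<cdot> x)) + x \<cdot> (y \<cdot> (x \<cdot> x)) + x \<cdot> (x \<cdot> (x \<cdot> y + y \<cdot> x))"
proof -
  define p s q where "p = x \<cdot> x" and "s = x \<cdot> y + y \<cdot> x" and "q = y \<cdot> y"
  have sq: "(x + t *\<^sub>R y) \<cdot> (x + t *\<^sub>R y) = p + t *\<^sub>R s + t^2 *\<^sub>R q" for t
    by (simp add: p_def s_def q_def bilin_simps algebra_simps power2_eq_square)
  have "p \<cdot> s + s \<cdot> p - (x \<cdot> (x \<cdot> s + y \<cdot> p) + y \<cdot> (x \<cdot> p)) = 0"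
  proof (rule quartic_linear_coeff_zero)
    fix t :: real
    show "(p \<cdot> p - x \<cdot> (x \<cdot> p))
      + t *\<^sub>R (p \<cdot> s + s \<cdot> p - (x \<cdot> (x \<cdot> s + y \<cdot> p) + y \<cdot> (x \<cdot> p)))
      + t^2 *\<^sub>R (s \<cdot> s + p \<cdot> q + q \<cdot> p - (x \<cdot> (x \<cdot> q + y \<cdot> s) + y \<cdot> (x \<cdot> s + y \<cdot> p)))
      + t^3 *\<^sub>R (s \<cdot> q + q \<cdot> s - (x \<cdot> (y \<cdot> q) + y \<cdot> (x \<cdot> q + y \<cdot> s)))
      + t^4 *\<^sub>R (q \<cdot> q - y \<cdot> (y \<cdot> q)) = 0"
      using assms[of "x + t *\<^sub>R y"] unfolding sq
      by (simp add: bilin_simps algebra_simps power2_eq_square power3_eq_cube power4_eq_xxxx)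
  qed
  then show ?thesis
    by (simp add: p_def s_def bilin_simps algebra_simps)
qed

text \<open>The once linearized identity is cubic in \<open>x\<close>, so replacing \<open>x\<close>
  by \<open>x + t *\<^sub>R z\<close> and again taking the linear coefficient frees a third
  variable. Two different powers of \<open>x\<close> can then be put for \<open>y\<close> and
  \<open>z\<close>.\<close>

lemma square_square_linearized2:
  assumes "\<And>x. (x \<cdot> x) \<cdot> (x \<cdot> x) = x \<cdot> (x \<cdot> (x \<cdot> x))"
  shows "(z \<cdot> y + y \<cdot> z) \<cdot> (x \<cdot> x) + (x \<cdot> y + y \<cdot> x) \<cdot> (x \<cdot> z + z \<cdot> x)
      + (x \<cdot> x) \<cdot> (z \<cdot> y + y \<cdot> z) + (x \<cdot> z + z \<cdot> x) \<cdot> (x \<cdot> y + y \<cdot> x)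
    = y \<cdot> (x \<cdot> (x \<cdot> z + z \<cdot> x) + z \<cdot> (x \<cdot> x)) + x \<cdot> (y \<cdot> (x \<cdot> z + z \<cdot> x)) + z \<cdot> (y \<cdot> (x \<cdot> x))
      + x \<cdot> (x \<cdot> (z \<cdot> y + y \<cdot> z) + z \<cdot> (x \<cdot> y + y \<cdot> x)) + z \<cdot> (x \<cdot> (x \<cdot> y + y \<cdot> x))"
proof -
  define p s q where "p = x \<cdot> x" and "s = x \<cdot> z + z \<cdot> x" and "q = z \<cdot> z"
  define a b where "a = x \<cdot> y + y \<cdot> x" and "b = z \<cdot> y + y \<cdot> z"
  have sq: "(x + t *\<^sub>R z) \<cdot> (x + t *\<^sub>R z) = p + t *\<^sub>R s + t^2 *\<^sub>R q" for t
    by (simp add: p_def s_def q_def bilin_simps algebra_simps power2_eq_square)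
  have jo: "(x + t *\<^sub>R z) \<cdot> y + y \<cdot> (x + t *\<^sub>R z) = a + t *\<^sub>R b" for t
    by (simp add: a_def b_def bilin_simps algebra_simps)
  have "b \<cdot> p + a \<cdot> s + p \<cdot> b + s \<cdot> a
    - (y \<cdot> (x \<cdot> s + z \<cdot> p) + x \<cdot> (y \<cdot> s) + z \<cdot> (y \<cdot> p) + x \<cdot> (x \<cdot> b + z \<cdot> a) + z \<cdot> (x \<cdot> a)) = 0"
  proof (rule quartic_linear_coeff_zero)
    fix t :: real
    show "(a \<cdot> p + p \<cdot> a - (y \<cdot> (x \<cdot> p) + x \<cdot> (y \<cdot> p) + x \<cdot> (x \<cdot> a)))
      + t *\<^sub>R (b \<cdot> p + a \<cdot> s + p \<cdot> b + s \<cdot> a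
        - (y \<cdot> (x \<cdot> s + z \<cdot> p) + x \<cdot> (y \<cdot> s) + z \<cdot> (y \<cdot> p) + x \<cdot> (x \<cdot> b + z \<cdot> a) + z \<cdot> (x \<cdot> a)))
      + t^2 *\<^sub>R (b \<cdot> s + a \<cdot> q + q \<cdot> a + s \<cdot> b
        - (y \<cdot> (x \<cdot> q + z \<cdot> s) + x \<cdot> (y \<cdot> q) + z \<cdot> (y \<cdot> s) + x \<cdot> (z \<cdot> b) + z \<cdot> (x \<cdot> b + z \<cdot> a)))
      + t^3 *\<^sub>R (b \<cdot> q + q \<cdot> b - (y \<cdot> (z \<cdot> q) + z \<cdot> (y \<cdot> q) + z \<cdot> (z \<cdot> b)))
      + t^4 *\<^sub>R 0 = 0"
      using square_square_linearized[OF assms, of "x + t *\<^sub>R z" y] unfolding sq jo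
      by (simp add: bilin_simps algebra_simps power2_eq_square power3_eq_cube)
  qed
  then show ?thesis
    by (simp add: p_def s_def a_def b_def)
qed

lemma cube_commutes_linearized:
  assumes "\<And>x. (x \<cdot> x) \<cdot> x = x \<cdot> (x \<cdot> x)"
  shows "y \<cdot> (x \<cdot> x) + x \<cdot> (x \<cdot> y + y \<cdot> x) = (x \<cdot> x) \<cdot> y + (x \<cdot> y + y \<cdot> x) \<cdot> x"
proof -
  define p s q where "p = x \<cdot> x" and "s = x \<cdot> y + y \<cdot> x" and "q = y \<cdot> y"
  have sq: "(x + t *\<^sub>R y) \<cdot> (x + t *\<^sub>R y) = p + t *\<^sub>R s + t^2 *\<^sub>R q" for t
    by (simp add: p_def s_def q_def bilin_simps algebra_simps power2_eq_square)
  have "y \<cdot> p + x \<cdot> s - p \<cdot> y - s \<cdot> x = 0"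
  proof (rule quartic_linear_coeff_zero)
    fix t :: real
    show "(x \<cdot> p - p \<cdot> x) + t *\<^sub>R (y \<cdot> p + x \<cdot> s - p \<cdot> y - s \<cdot> x)
      + t^2 *\<^sub>R (y \<cdot> s + x \<cdot> q - s \<cdot> y - q \<cdot> x) + t^3 *\<^sub>R (y \<cdot> q - q \<cdot> y) + t^4 *\<^sub>R 0 = 0"
      using assms[of "x + t *\<^sub>R y"] unfolding sq
      by (simp add: bilin_simps algebra_simps power2_eq_square power3_eq_cube)
  qed
  then show ?thesis
    by (simp add: p_def s_def algebra_simps)
qed

text \<open>With \<open>z\<close> fixed, \<open>cube_commutes_linearized\<close> is quadratic in the
  other variable; its polar form \<open>h (x + y) - h x - h y\<close> is the symmetric trilinear
  version.\<close>

lemma cube_commutes_linearized2: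
  assumes "\<And>x. (x \<cdot> x) \<cdot> x = x \<cdot> (x \<cdot> x)"
  shows "x \<cdot> (y \<cdot> z + z \<cdot> y) + y \<cdot> (z \<cdot> x + x \<cdot> z) + z \<cdot> (x \<cdot> y + y \<cdot> x)
    = (y \<cdot> z + z \<cdot> y) \<cdot> x + (z \<cdot> x + x \<cdot> z) \<cdot> y + (x \<cdot> y + y \<cdot> x) \<cdot> z"
proof -
  define h where "h w = z \<cdot> (w \<cdot> w) + w \<cdot> (w \<cdot> z + z \<cdot> w) - (w \<cdot> w) \<cdot> z - (w \<cdot> z + z \<cdot> w) \<cdot> w" for w
  have h0: "h w = 0" for w
    using cube_commutes_linearized[OF assms, of z w] by (simp add: h_def algebra_simps)
  have "x \<cdot> (y \<cdot> z + z \<cdot> y) + y \<cdot> (z \<cdot> x + x \<cdot> z) + z \<cdot> (x \<cdot> y + y \<cdot> x)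
    - ((y \<cdot> z + z \<cdot> y) \<cdot> x + (z \<cdot> x + x \<cdot> z) \<cdot> y + (x \<cdot> y + y \<cdot> x) \<cdot> z)
    = h (x + y) - h x - h y"
    unfolding h_def by (simp add: bilin_simps algebra_simps)
  then show ?thesis by (simp add: h0)
qed

end

section \<open>Power associativity\<close>

locale power_assoc_conditions = real_algebra_product +
  fixes e :: "'a::real_vector"
  assumes lunit [simp]: "e \<cdot> x = x" and runit [simp]: "x \<cdot> e = x"
    and cube: "(x \<cdot> x) \<cdot> x = x \<cdot> (x \<cdot> x)"
    and fourth: "(x \<cdot> x) \<cdot> (x \<cdot> x) = x \<cdot> (x \<cdot> (x \<cdot> x))"
begin

primrec pw :: "'a \<Rightarrow> nat \<Rightarrow> 'a" where
  "pw x 0 = e"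
| "pw x (Suc n) = x \<cdot> pw x n"

text \<open>Recursion \<open>rec\<close> from the proof of \<open>pw_add\<close>, with
  \<open>g 2\<close> as unit of measurement: the initial values reflect
  \<open>g 0 = g 1 = 0\<close>, and the summand 4 comes from \<open>4 *\<^sub>R g 2\<close>.\<close>

fun weight :: "nat \<Rightarrow> real" where
  "weight 0 = 0"
| "weight (Suc 0) = 0"
| "weight (Suc (Suc 0)) = 1"
| "weight (Suc (Suc (Suc k))) = (8 * weight (Suc (Suc k)) - 3 * weight (Suc k) + 4) / 3"

text \<open>For consecutive values \<open>0 \<le> a < b\<close> the next increment is
  \<open>(5 * b - 3 * a + 4) / 3 > 0\<close>, so nonnegativity and growth are carried through the
  induction together.\<close>

lemma weight_mono: "0 \<le> weight (Suc k) \<and> weight (Suc k) < weight (Suc (Suc k))"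
  by (induction k) (auto simp: field_simps)

text \<open>The commutators \<open>c k\<close> of complementary powers grow additively, so
  \<open>c k = real k *\<^sub>R c 1\<close>. Antisymmetry gives \<open>c (n - 1) = - c 1\<close>,
  hence \<open>real n *\<^sub>R c 1 = 0\<close>.\<close>

lemma pw_commute_step:
  assumes IH: "\<And>i j. i + j < n \<Longrightarrow> pw x i \<cdot> pw x j = pw x (i + j)"
    and "n > 0" "i + j = n"
  shows "pw x i \<cdot> pw x j = pw x j \<cdot> pw x i"
proof -
  define c where "c k = pw x k \<cdot> pw x (n - k) - pw x (n - k) \<cdot> pw x k" for k
  have step: "c (Suc k) = c k + c 1" if "k > 0" "Suc k < n" for k
  proof -
    define l where "l = n - Suc k"
    have l: "l > 0" "k + l < n" "n - Suc k = l" "n - k = Suc l" "n - 1 = k + l" "n - Suc 0 = k + l"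
      using that by (auto simp: l_def)
    have "pw x 1 \<cdot> pw x k = pw x (Suc k)" "pw x k \<cdot> pw x 1 = pw x (Suc k)"
      "pw x 1 \<cdot> pw x l = pw x (Suc l)" "pw x l \<cdot> pw x 1 = pw x (Suc l)"
      "pw x k \<cdot> pw x l = pw x (k + l)" "pw x l \<cdot> pw x k = pw x (k + l)"
      using that l IH[of 1 k] IH[of k 1] IH[of 1 l] IH[of l 1] IH[of k l] IH[of l k]
      by (simp_all add: add.commute del: pw.simps)
    \<comment> \<open>Since \<open>1 + k + l = n\<close>, each inner product has degree below
      \<open>n\<close> and is a power by \<open>IH\<close>. What remains is twice a sum of three
      commutators of total degree \<open>n\<close>.\<close>
    note * = cube_commutes_linearized2[OF cube, of "pw x 1" "pw x k" "pw x l", unfolded this]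
    have "2 *\<^sub>R (c (Suc k) - c k - c 1) = 0"
      using * unfolding c_def l
      by (simp add: scaleR_2 bilin_simps algebra_simps del: pw.simps)
    then have "c (Suc k) - c k - c 1 = 0" by simp
    then show ?thesis by (simp add: algebra_simps)
  qed
  have c_eq: "c k = real k *\<^sub>R c 1" if "k < n" for k
    using that
  proof (induction k)
    case 0
    show ?case by (simp add: c_def)
  next
    case (Suc k)
    then show ?case
      using step[of k] by (cases "k = 0") (auto simp: algebra_simps)
  qed
  have "c 1 = 0"
  proof (cases "n = 1")
    case True
    then show ?thesis by (simp add: c_def)
  next
    case False
    have "c (n - 1) = - c 1"
      using \<open>n > 0\<close> by (simp add: c_def del: pw.simps)
    with c_eq[of "n - 1"] \<open>n > 0\<close> have "real n *\<^sub>R c 1 = 0"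
      by (simp add: algebra_simps of_nat_diff)
    with \<open>n > 0\<close> show ?thesis by simp
  qed
  then have "c k = 0" if "k < n" for k
    using c_eq[OF that] by simp
  moreover have "c n = 0" by (simp add: c_def)
  ultimately have "c i = 0"
    using assms(3) by (cases "i = n") auto
  then show ?thesis using assms(3) by (auto simp: c_def)
qed

text \<open>Albert's induction on the total degree \<open>n\<close>. By the linearized fourth-degree identity the defects
  \<open>g k = x\<^sup>k x\<^sup>n\<^sup>-\<^sup>k - x\<^sup>n\<close> satisfy a linear recursion with solution
  \<open>g k = weight k *\<^sub>R g 2\<close>, and \<open>g (n - 1) = 0\<close> then kills all of them.\<close>

lemma pw_add: "pw x i \<cdot> pw x j = pw x (i + j)"
proof (induction "i + j" arbitrary: i j rule: less_induct)
  case less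
  define n where "n = i + j"
  have IH: "pw x i \<cdot> pw x j = pw x (i + j)" if "i + j < n" for i j
    using less that by (simp add: n_def)
  have pw1: "pw x (Suc 0) = x" by simp
  have x_pw: "x \<cdot> pw x k = pw x (Suc k)" for k by simp
  have pw_x: "pw x k \<cdot> x = pw x (Suc k)" if "Suc k < n" for k
    using IH[of k 1] that by simp
  have pp: "pw x i \<cdot> pw x j = pw x k" if "i + j = k" "k < n" for i j k
    using IH that by simp
  show ?case
  proof (cases "n \<le> 2")
    case True
    then have "i = 0 \<or> j = 0 \<or> i = 1" by (auto simp: n_def)
    then show ?thesis by auto
  next
    case False
    have comm: "pw x k \<cdot> pw x l = pw x l \<cdot> pw x k" if "k + l = n" for k l
      using pw_commute_step[of n x k l] IH that False by simp
    define g where "g k = pw x k \<cdot> pw x (n - k) - pw x n" for k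
    have g_prod: "pw x k \<cdot> pw x l = g k + pw x n" if "k + l = n" for k l
      using that by (auto simp: g_def)
    have g_sym: "g (n - k) = g k" if "k \<le> n" for k
      using that comm[of k "n - k"] by (simp add: g_def)
    have g1: "g 1 = 0"
      using False x_pw[of "n - 1"] by (simp add: g_def pw1 del: pw.simps)
    have rec: "3 *\<^sub>R g (Suc (Suc k)) = 8 *\<^sub>R g (Suc k) - 3 *\<^sub>R g k + 4 *\<^sub>R g 2"
      if "k > 0" "Suc (Suc k) < n" for k
    proof -
      define l where "l = n - Suc (Suc k)"
      have l: "l > 0" "n = Suc (Suc (k + l))"
        using that by (auto simp: l_def)
      have gs: "g (Suc l) = g (Suc k)" "g l = g (Suc (Suc k))" "g (k + l) = g 2"
        using g_sym[of "Suc k"] g_sym[of "Suc (Suc k)"] g_sym[of 2] l by simp_all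
      have xx: "x \<cdot> x = pw x 2"
        by (simp add: numeral_2_eq_2)
      have prods: "pw x l \<cdot> pw x k = pw x (k + l)" "pw x k \<cdot> pw x l = pw x (k + l)"
        "pw x k \<cdot> x = pw x (Suc k)" "pw x l \<cdot> x = pw x (Suc l)"
        "pw x l \<cdot> pw x 2 = pw x (Suc (Suc l))" "pw x k \<cdot> pw x 2 = pw x (Suc (Suc k))"
        "pw x k \<cdot> pw x (Suc l) = pw x (Suc (k + l))"
        "pw x l \<cdot> pw x (Suc k) = pw x (Suc (k + l))"
        by (rule pp pw_x; use l that in simp)+
      have tops: "pw x (k + l) \<cdot> pw x 2 = g 2 + pw x n" "pw x 2 \<cdot> pw x (k + l) = g 2 + pw x n"
        "pw x (Suc k) \<cdot> pw x (Suc l) = g (Suc k) + pw x n"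
        "pw x (Suc l) \<cdot> pw x (Suc k) = g (Suc k) + pw x n"
        "pw x k \<cdot> pw x (Suc (Suc l)) = g k + pw x n"
        "pw x l \<cdot> pw x (Suc (Suc k)) = g (Suc (Suc k)) + pw x n"
        using g_prod[of "k + l" 2] g_prod[of 2 "k + l"] g_prod[of "Suc k" "Suc l"]
          g_prod[of "Suc l" "Suc k"] g_prod[of k "Suc (Suc l)"] g_prod[of l "Suc (Suc k)"] gs l
        by (simp_all del: pw.simps)
      have top: "pw x (Suc (Suc (k + l))) = pw x n"
        using l by simp
      have scale_sums: "3 *\<^sub>R v = v + v + v" "4 *\<^sub>R v = v + v + v + v"
        "8 *\<^sub>R v = v + v + v + v + v + v + v + v" for v :: 'a
        using scaleR_left_distrib[of 2 1 v] scaleR_left_distrib[of 2 2 v]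
          scaleR_left_distrib[of 4 4 v] by (simp_all add: scaleR_2 add.assoc)
      \<comment> \<open>Here \<open>k + l + 2 = n\<close>, and \<open>k, l > 0\<close> keeps every
        inner product below degree \<open>n\<close>. The outer products become \<open>pw x n\<close>
        plus a defect, those with left factor \<open>x\<close> having none; the 12 copies of
        \<open>pw x n\<close> on each side cancel.\<close>
      note * = square_square_linearized2[OF fourth, where x = x and y = "pw x k" and z = "pw x l"]
      have "4 *\<^sub>R g 2 + 8 *\<^sub>R g (Suc k) = 3 *\<^sub>R g k + 3 *\<^sub>R g (Suc (Suc k))"
        using * by (simp add: xx x_pw prods tops top scale_sums bilin_simps algebra_simps del: pw.simps)
      then show ?thesis by (simp add: algebra_simps)
    qed
    have g_weight: "g k = weight k *\<^sub>R g 2" if "k > 0" "k < n" for k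
      using that
    proof (induction k rule: weight.induct)
      case (4 k)
      have "3 *\<^sub>R g (Suc (Suc (Suc k)))
        = (8 * weight (Suc (Suc k)) - 3 * weight (Suc k) + 4) *\<^sub>R g 2"
        using rec[of "Suc k"] 4 by (simp add: scaleR_left_distrib scaleR_left_diff_distrib)
      also have "\<dots> = 3 *\<^sub>R (weight (Suc (Suc (Suc k))) *\<^sub>R g 2)"
        by simp
      finally have "3 *\<^sub>R (g (Suc (Suc (Suc k))) - weight (Suc (Suc (Suc k))) *\<^sub>R g 2) = 0"
        by (simp only: scaleR_right_diff_distrib right_minus_eq)
      then show ?case by simp
    qed (use g1 in \<open>auto simp: numeral_2_eq_2\<close>)
    have "g (n - 1) = 0"
      using g_sym[of 1] g1 False by simp
    then have "weight (n - 1) *\<^sub>R g 2 = 0"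
      using g_weight[of "n - 1"] False by simp
    \<comment> \<open>As \<open>n\<close> is at least 3, \<open>n - 1 = Suc (Suc (n - 3))\<close>,
      which is the strictly larger index in \<open>weight_mono\<close>.\<close>
    moreover have "weight (n - 1) > 0"
      using weight_mono[of "n - 3"] False by (simp add: numeral_3_eq_3 Suc_diff_Suc)
    ultimately have "g 2 = 0" by simp
    then have "g i = 0" if "i > 0" "j > 0"
      using g_weight[of i] that by (simp add: n_def)
    moreover have "g i = pw x i \<cdot> pw x j - pw x (i + j)"
      by (simp add: g_def n_def)
    ultimately show ?thesis
      by (cases "i = 0 \<or> j = 0") auto
  qed
qed

section \<open>Evaluation of real polynomials\<close>

definition ev :: "'a \<Rightarrow> real poly \<Rightarrow> 'a" where
  "ev x p = (\<Sum>i\<le>degree p. coeff p i *\<^sub>R pw x i)"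

lemma ev_eq_sum:
  assumes "degree p \<le> n"
  shows "ev x p = (\<Sum>i\<le>n. coeff p i *\<^sub>R pw x i)"
  unfolding ev_def using assms
  by (intro sum.mono_neutral_left) (auto simp: coeff_eq_0)

lemma ev_add: "ev x (p + q) = ev x p + ev x q"
proof -
  define n where "n = max (degree p) (degree q)"
  have "degree (p + q) \<le> n" unfolding n_def by (rule degree_add_le_max)
  then show ?thesis
    using ev_eq_sum[of p n x] ev_eq_sum[of q n x] ev_eq_sum[of "p + q" n x]
    by (simp add: n_def algebra_simps sum.distrib)
qed

lemma ev_smult: "ev x (smult a p) = a *\<^sub>R ev x p"
  using ev_eq_sum[of "smult a p" "degree p" x] by (simp add: ev_def scaleR_sum_right)

lemma mult_sum_right: "a \<cdot> (\<Sum>i\<in>I. f i) = (\<Sum>i\<in>I. a \<cdot> f i)"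
  using bilin unfolding bilinear_def by (simp add: linear_sum)

lemma ev_pCons: "ev x (pCons a p) = a *\<^sub>R e + x \<cdot> ev x p"
proof -
  have "ev x (pCons a p) = (\<Sum>i\<le>Suc (degree p). coeff (pCons a p) i *\<^sub>R pw x i)"
    by (rule ev_eq_sum) (rule degree_pCons_le)
  also have "\<dots> = a *\<^sub>R e + x \<cdot> ev x p"
    by (simp add: ev_def sum.atMost_Suc_shift mult_sum_right rmul del: sum.atMost_Suc)
  finally show ?thesis .
qed

lemma ev_in_span: "ev x p \<in> span (range (pw x))"
  unfolding ev_def by (intro span_sum span_scale span_base) simp

text \<open>On powers both sides equal \<open>pw x (Suc (i + j))\<close> by \<open>pw_add\<close>;
  bilinearity extends this to the span in each factor.\<close>

lemma assoc_on_span: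
  assumes "u \<in> span (range (pw x))" "v \<in> span (range (pw x))"
  shows "x \<cdot> (u \<cdot> v) = (x \<cdot> u) \<cdot> v"
  using assms(1)
proof (induction rule: span_induct_alt)
  case base
  show ?case by simp
next
  case (step c u w)
  then obtain i where i: "u = pw x i" by auto
  from assms(2) have "x \<cdot> (u \<cdot> v) = (x \<cdot> u) \<cdot> v"
  proof (induction rule: span_induct_alt)
    case (step d v' w')
    then obtain j where j: "v' = pw x j" by auto
    show ?case
      using step pw_add[of x i j] pw_add[of x "Suc i" j] by (simp add: i j bilin_simps)
  qed simp
  with step show ?case by (simp add: bilin_simps)
qed

text \<open>Horner induction on \<open>p\<close>: the constant term is handled by the unit
  \<open>e\<close>, and a leading factor \<open>x\<close> is moved across the product by
  \<open>assoc_on_span\<close>.\<close>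

lemma ev_mult: "ev x (p * q) = ev x p \<cdot> ev x q"
proof (induction p)
  case 0
  show ?case by (simp add: ev_def)
next
  case (pCons a p)
  then show ?case
    using assoc_on_span[OF ev_in_span ev_in_span, of x p q]
    by (simp add: ev_add ev_smult ev_pCons bilin_simps)
qed

text \<open>The \<open>card B + 1\<close> powers with exponents up to \<open>card B\<close> form a
  dependent family, and the coefficients of a relation are those of the polynomial.\<close>

lemma annihilating_poly_exists:
  assumes "finite B" "span B = (UNIV :: 'a set)"
  shows "\<exists>p. p \<noteq> 0 \<and> ev x p = 0"
proof -
  let ?I = "{..card B}"
  obtain c where c: "\<exists>i\<in>?I. c i \<noteq> 0" "(\<Sum>i\<in>?I. c i *\<^sub>R pw x i) = 0"
  proof (cases "inj_on (pw x) ?I")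
    case True
    have "dependent (pw x ` ?I)"
    proof (rule ccontr)
      assume "independent (pw x ` ?I)"
      from independent_span_bound[OF assms(1) this] have "card (pw x ` ?I) \<le> card B"
        using assms(2) by simp
      with True show False by (simp add: card_image)
    qed
    then obtain u where "\<exists>v\<in>pw x ` ?I. u v \<noteq> 0" "(\<Sum>v\<in>pw x ` ?I. u v *\<^sub>R v) = 0"
      using dependent_finite[of "pw x ` ?I"] by auto
    then show ?thesis
      using that[of "u \<circ> pw x"] sum.reindex[OF True, of "\<lambda>v. u v *\<^sub>R v"] by auto
  next
    case False
    then obtain i j where ij: "i \<in> ?I" "j \<in> ?I" "i \<noteq> j" "pw x i = pw x j"
      by (auto simp: inj_on_def)
    \<comment> \<open>If two powers coincide, the set of powers may lose the dependence of the
      family; the relation is then that of the polynomial \<open>X^i - X^j\<close>.\<close>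
    let ?c = "\<lambda>k. (if k = i then 1 else 0) - (if k = j then 1 else (0::real))"
    have "(\<Sum>k\<in>?I. ?c k *\<^sub>R pw x k) = 0"
      using ij by (simp add: scaleR_left_diff_distrib sum_subtractf if_distrib[of "\<lambda>r. r *\<^sub>R _"] sum.delta cong: if_cong)
    with ij show ?thesis by (intro that[of ?c]) auto
  qed
  define p where "p = (\<Sum>i\<in>?I. monom (c i) i)"
  have coeff_p: "coeff p i = (if i \<in> ?I then c i else 0)" for i
    by (simp add: p_def coeff_sum)
  have "degree p \<le> card B"
    by (rule degree_le) (simp add: coeff_p)
  then have "ev x p = 0"
    using c(2) by (simp add: ev_eq_sum coeff_p)
  moreover have "p \<noteq> 0"
    using c(1) coeff_p by (metis coeff_0)
  ultimately show ?thesis by blast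
qed

end

section \<open>Factors of real polynomials\<close>

text \<open>A complex root yields a real linear factor if it is real, and otherwise the quadratic
  factor belonging to it and its conjugate.\<close>

lemma real_poly_factor:
  fixes p :: "real poly"
  assumes "degree p > 2"
  shows "\<exists>d q. p = d * q \<and> 0 < degree d \<and> degree d \<le> 2"
proof -
  have lin: "map_poly complex_of_real (f + g) = map_poly complex_of_real f + map_poly complex_of_real g"
    for f g by (intro poly_eqI) (simp add: coeff_map_poly)
  have mul: "map_poly complex_of_real (f * g) = map_poly complex_of_real f * map_poly complex_of_real g"
    for f g by (intro poly_eqI) (simp add: coeff_map_poly coeff_mult)
  have "\<not> constant (poly (map_poly complex_of_real p))"
    using assms by (simp add: constant_degree degree_map_poly)
  then obtain z where z: "poly (map_poly complex_of_real p) z = 0"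
    using fundamental_theorem_of_algebra by blast
  show ?thesis
  proof (cases "Im z = 0")
    case True
    then have "z = complex_of_real (Re z)" by (simp add: complex_eq_iff)
    with z have "complex_of_real (poly p (Re z)) = 0"
      by (simp add: poly_altdef degree_map_poly coeff_map_poly)
    then have "[:- Re z, 1:] dvd p" by (simp add: poly_eq_0_iff_dvd)
    then obtain q where "p = [:- Re z, 1:] * q" by (elim dvdE)
    then show ?thesis
      by (intro exI[of _ "[:- Re z, 1:]"] exI[of _ q]) simp
  next
    case False
    \<comment> \<open>This is \<open>(X - z) (X - cnj z)\<close> expanded.\<close>
    define d where "d = [:(Re z)^2 + (Im z)^2, - 2 * Re z, 1:]"
    have d0: "poly (map_poly complex_of_real d) z = 0"
      by (simp add: d_def map_poly_pCons complex_eq_iff power2_eq_square algebra_simps)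
    have degd: "degree d = 2" by (simp add: d_def)
    then have "d \<noteq> 0" by auto
    define r where "r = p mod d"
    have "degree r < 2"
      using degree_mod_less[OF \<open>d \<noteq> 0\<close>, of p] degd unfolding r_def by auto
    then have r: "r = [:coeff r 0, coeff r 1:]"
      by (intro poly_eqI) (auto simp: coeff_pCons coeff_eq_0 split: nat.split)
    have "map_poly complex_of_real p = map_poly complex_of_real d * map_poly complex_of_real (p div d)
      + map_poly complex_of_real r"
      unfolding r_def by (simp flip: lin mul)
    with z d0 have "poly (map_poly complex_of_real r) z = 0" by simp
    then have "complex_of_real (coeff r 0) + z * complex_of_real (coeff r 1) = 0"
      by (subst (asm) r) (simp add: map_poly_pCons)
    \<comment> \<open>The imaginary part reads \<open>Im z * coeff r 1 = 0\<close>: a nonzero real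
      polynomial of degree at most 1 has no non-real root.\<close>
    with False have "coeff r 1 = 0 \<and> coeff r 0 = 0"
      by (auto simp: complex_eq_iff)
    then have "r = 0" using r by simp
    then have "p = d * (p div d)" unfolding r_def by (metis mod_0_imp_dvd dvd_mult_div_cancel)
    with degd show ?thesis by (metis order_refl zero_less_numeral)
  qed
qed

section \<open>Annihilating polynomials of degree at most 2\<close>

context power_assoc_conditions
begin

text \<open>Without zero divisors, an annihilating polynomial can be replaced by one of its real
  irreducible factors.\<close>

lemma annihilating_poly_degree_le_2:
  assumes nzd: "\<And>a b. a \<cdot> b = 0 \<Longrightarrow> a = 0 \<or> b = 0"
    and "p \<noteq> 0" "ev x p = 0"
  shows "\<exists>p. p \<noteq> 0 \<and> degree p \<le> 2 \<and> ev x p = 0"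
  using assms(2,3)
proof (induction "degree p" arbitrary: p rule: less_induct)
  case less
  show ?case
  proof (cases "degree p \<le> 2")
    case False
    then obtain d q where dq: "p = d * q" "0 < degree d" "degree d \<le> 2"
      using real_poly_factor[of p] by auto
    with less.prems have nz: "d \<noteq> 0" "q \<noteq> 0" by auto
    then have "degree q < degree p"
      using dq by (simp add: degree_mult_eq)
    moreover have "ev x d = 0 \<or> ev x q = 0"
      using nzd less.prems(2) dq(1) by (simp add: ev_mult)
    ultimately show ?thesis
      using less.hyps[of q] nz dq(3) by blast
  qed (use less.prems in blast)
qed

text \<open>The three coefficients of an annihilating polynomial of degree at most 2 give the
  relation; its leading coefficient is among them, so it is nontrivial.\<close>

lemma linearly_dependent3_square:
  assumes "\<And>a b. a \<cdot> b = 0 \<Longrightarrow> a = 0 \<or> b = 0"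
    and "finite B" "span B = (UNIV :: 'a set)"
  shows "linearly_dependent3 e x (x \<cdot> x)"
proof -
  obtain p where p: "p \<noteq> 0" "degree p \<le> 2" "ev x p = 0"
    using annihilating_poly_exists[OF assms(2,3), of x] annihilating_poly_degree_le_2[OF assms(1)]
    by blast
  have "coeff p 0 *\<^sub>R e + coeff p 1 *\<^sub>R x + coeff p 2 *\<^sub>R (x \<cdot> x) = 0"
    using p(3) ev_eq_sum[OF p(2), of x] by (simp add: numeral_2_eq_2)
  moreover have "(coeff p 0, coeff p 1, coeff p 2) \<noteq> (0, 0, 0)"
  proof
    assume *: "(coeff p 0, coeff p 1, coeff p 2) = (0, 0, 0)"
    have "degree p \<in> {0, 1, 2}" using p(2) by auto
    with * have "coeff p (degree p) = 0" by (elim insertE) auto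
    with p(1) show False by simp
  qed
  ultimately show ?thesis unfolding linearly_dependent3_def by blast
qed

end

section \<open>Right unit, cube identity and conclusion\<close>

theorem theorem1:
  fixes m :: "'a::real_vector \<Rightarrow> 'a \<Rightarrow> 'a" and e :: 'a
  assumes "real_division_algebra m"
    and "left_unit m e"
    and "\<And>x. associator m x x (m x x) = 0"
  shows "two_sided_unit m e \<and> quadratic_algebra m"
proof -
  interpret real_algebra_product m
    using assms(1) by unfold_locales (simp add: real_division_algebra_def)
  note bij = assms(1)[unfolded real_division_algebra_def, THEN conjunct2, THEN conjunct2, THEN conjunct2]
  have lunit: "m e x = x" for x
    using assms(2) by (simp add: left_unit_def)
  have fourth: "m (m x x) (m x x) = m x (m x (m x x))" for x
    using assms(3)[of x] by (simp add: associator_def)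
  have nzd: "a = 0 \<or> b = 0" if "m a b = 0" for a b
  proof (rule ccontr)
    assume *: "\<not> (a = 0 \<or> b = 0)"
    then have "inj (m a)" using bij by (auto simp: bij_def)
    from injD[OF this, of b 0] that * show False by simp
  qed
  have "e \<noteq> 0"
  proof
    assume "e = 0"
    then have "x = 0" for x :: 'a using lunit[of x] by simp
    with assms(1) show False by (auto simp: real_division_algebra_def)
  qed
  have runit: "m x e = x" for x
  proof -
    \<comment> \<open>At base point \<open>e\<close> in direction \<open>x\<close>, the linearized
      identity reads \<open>(xe)e + 2 xe + x = 3 xe + x\<close>.\<close>
    have "m (m x e) e = m x e"
      using square_square_linearized[OF fourth, of e x] by (simp add: lunit bilin_simps)
    then have "m (m x e - x) e = 0" by (simp add: lsub)
    with nzd \<open>e \<noteq> 0\<close> show ?thesis by force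
  qed
  have cube: "m (m x x) x = m x (m x x)" for x
  proof -
    \<comment> \<open>In direction \<open>e\<close>, now a two-sided unit, the identity reads
      \<open>2 x(xx) + 2 (xx)x = 4 x(xx)\<close>.\<close>
    have "2 *\<^sub>R (m (m x x) x - m x (m x x)) = 0"
      using square_square_linearized[OF fourth, of x e]
      by (simp add: lunit runit bilin_simps scaleR_2 algebra_simps)
    then show ?thesis by simp
  qed
  interpret power_assoc_conditions m e
    by unfold_locales (fact lunit runit cube fourth)+
  obtain B :: "'a set" where "finite B" "span B = UNIV"
    using assms(1) by (auto simp: real_division_algebra_def)
  then have "linearly_dependent3 e x (m x x)" for x
    using linearly_dependent3_square nzd by blast
  then show ?thesis
    using bilin lunit runit unfolding two_sided_unit_def quadratic_algebra_def by blast
qed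

end
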